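(* Let $\mathbf{p}=\{p_1,\dots,p_n\}$ and $\mathbf{r}=\{r_1,\dots,r_n\}$ be two probability distributions with $p_j>0$ and $r_j>0$ for all $j=1,\dots,n$, and let $0\le q<1$. Then $$\frac q8\sum_{j=1}^n(p_j-r_j)^2\left(\frac1{p_j+\max\{p_j,r_j\}}+\frac1{r_j+\max\{p_j,r_j\}}\right)\le JS_q(\mathbf{p}|\mathbf{r})$$ and $$JS_q(\mathbf{p}|\mathbf{r})\le\frac q8\sum_{j=1}^n(p_j-r_j)^2\left(\frac1{p_j+\min\{p_j,r_j\}}+\frac1{r_j+\min\{p_j,r_j\}}\right).$$
   Context: A probability distribution satisfies $\sum_j p_j=1$. For probability distributions $\mathbf{p},\mathbf{r}$ with positive entries and $q\ge0$, $q\ne1$, the Tsallis divergence is $D_q^T(\mathbf{p}|\mathbf{r}):=\sum_{j=1}^n\frac{p_j-p_j^qr_j^{1-q}}{1-q}$. The Jensen-Shannon-Tsallis divergence is $JS_q(\mathbf{p}|\mathbf{r}):=\frac12D_q^T\left(\mathbf{p}\,\Big|\,\frac{\mathbf{p}+\mathbf{r}}{2}\right)+\frac12D_q^T\left(\mathbf{r}\,\Big|\,\frac{\mathbf{p}+\mathbf{r}}{2}\right)$, where $\frac{\mathbf{p}+\mathbf{r}}{2}$ is the distribution with entries $\frac{p_j+r_j}{2}$. *)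

theory Defs
  imports Complex_Main
begin

text \<open>A distribution with n entries is a function on the naturals of which only the values at
  the indices 1 to n are used. The divergences are meant for positive entries, where
  \<open>powr\<close> is the usual real power (with exponent 0 giving 1), and for \<open>q \<noteq> 1\<close>.\<close>

definition tsallis_divergence :: "real \<Rightarrow> nat \<Rightarrow> (nat \<Rightarrow> real) \<Rightarrow> (nat \<Rightarrow> real) \<Rightarrow> real" where
  "tsallis_divergence q n p r =
     (\<Sum>j=1..n. (p j - p j powr q * r j powr (1 - q)) / (1 - q))"

definition jensen_shannon_tsallis :: "real \<Rightarrow> nat \<Rightarrow> (nat \<Rightarrow> real) \<Rightarrow> (nat \<Rightarrow> real) \<Rightarrow> real" where
  "jensen_shannon_tsallis q n p r =
     1/2 * tsallis_divergence q n p (\<lambda>j. (p j + r j) / 2)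
   + 1/2 * tsallis_divergence q n r (\<lambda>j. (p j + r j) / 2)"

end

theory Submission
  imports Defs
begin

text \<open>
  Both inequalities hold summand by summand. Fix an index with entries \<open>a\<close> and \<open>b\<close>, write
  \<open>m = (a + b) / 2\<close> and, by symmetry, \<open>a = m (1 + s)\<close>, \<open>b = m (1 - s)\<close> with \<open>0 \<le> s < 1\<close>.
  The powers of \<open>m\<close> combine by homogeneity, and the summand of the divergence becomes
  \<open>m G(s) / (2 (1 - q))\<close> with \<open>G(s) = 2 - (1 + s)\<^sup>q - (1 - s)\<^sup>q\<close>. The two bounds become
  multiples of \<open>s\<^sup>2 (1 + 1 / (1 + s))\<close> and \<open>s\<^sup>2 (1 + 1 / (1 - s))\<close>.

  The function \<open>G\<close> vanishes to second order at 0, and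
  \<open>G''(s) = q (1 - q) ((1 + s)\<^bsup>q - 2\<^esup> + (1 - s)\<^bsup>q - 2\<^esup>)\<close>. The bracket is at least 2 by
  the inequality of arithmetic and geometric means, which gives \<open>G(s) \<ge> q (1 - q) s\<^sup>2\<close>, stronger than the lower bound
  because \<open>1 + 1 / (1 + s) \<le> 2\<close>. The bracket is at most \<open>1 + (1 - s)\<^bsup>-3\<^esup>\<close>, which is the second derivative of
  \<open>(s\<^sup>2 + s\<^sup>2 / (1 - s)) / 2\<close>; this gives the upper bound
  (\<open>powr_symmetric_defect_lower\<close> and \<open>powr_symmetric_defect_upper\<close>).
\<close>

lemma le_by_second_derivative:
  fixes f g :: "real \<Rightarrow> real"
  assumes s: "0 \<le> s"
    and f: "\<And>x. 0 \<le> x \<Longrightarrow> x \<le> s \<Longrightarrow> (f has_real_derivative f' x) (at x)"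
           "\<And>x. 0 \<le> x \<Longrightarrow> x \<le> s \<Longrightarrow> (f' has_real_derivative f'' x) (at x)"
    and g: "\<And>x. 0 \<le> x \<Longrightarrow> x \<le> s \<Longrightarrow> (g has_real_derivative g' x) (at x)"
           "\<And>x. 0 \<le> x \<Longrightarrow> x \<le> s \<Longrightarrow> (g' has_real_derivative g'' x) (at x)"
    and start: "f 0 = g 0" "f' 0 = g' 0"
    and le: "\<And>x. 0 \<le> x \<Longrightarrow> x \<le> s \<Longrightarrow> f'' x \<le> g'' x"
  shows "f s \<le> g s"
proof -
  have slope: "f' x \<le> g' x" if "0 \<le> x" "x \<le> s" for x
  proof -
    have "g' 0 - f' 0 \<le> g' x - f' x"
    proof (rule DERIV_nonneg_imp_nondecreasing[OF \<open>0 \<le> x\<close>])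
      fix y assume "0 \<le> y" "y \<le> x"
      then have "((\<lambda>x. g' x - f' x) has_real_derivative g'' y - f'' y) (at y)"
        "0 \<le> g'' y - f'' y"
        using that f(2) g(2) le by (auto intro!: DERIV_diff)
      then show "\<exists>d. ((\<lambda>x. g' x - f' x) has_real_derivative d) (at y) \<and> 0 \<le> d"
        by blast
    qed
    then show ?thesis using start by simp
  qed
  have "g 0 - f 0 \<le> g s - f s"
  proof (rule DERIV_nonneg_imp_nondecreasing[OF s])
    fix y assume "0 \<le> y" "y \<le> s"
    then have "((\<lambda>x. g x - f x) has_real_derivative g' y - f' y) (at y)" "0 \<le> g' y - f' y"
      using f(1) g(1) slope by (auto intro!: DERIV_diff)
    then show "\<exists>d. ((\<lambda>x. g x - f x) has_real_derivative d) (at y) \<and> 0 \<le> d"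
      by blast
  qed
  then show ?thesis using start by simp
qed

lemma powr_symmetric_defect_derivatives:
  fixes q x :: real
  assumes "0 \<le> x" "x < 1"
  shows "((\<lambda>x. 2 - (1 + x) powr q - (1 - x) powr q) has_real_derivative
            q * ((1 - x) powr (q - 1) - (1 + x) powr (q - 1))) (at x)"
    and "((\<lambda>x. q * ((1 - x) powr (q - 1) - (1 + x) powr (q - 1))) has_real_derivative
            q * (1 - q) * ((1 + x) powr (q - 2) + (1 - x) powr (q - 2))) (at x)"
  using assms by (auto intro!: derivative_eq_intros simp: algebra_simps)

text \<open>By the inequality of arithmetic and geometric means, the sum is at least twice the square
  root of \<open>(1 - x\<^sup>2) powr c\<close>, a power of a number in \<open>(0, 1]\<close> with nonpositive exponent.\<close>

lemma two_le_powr_symmetric_sum: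
  fixes c x :: real
  assumes "0 \<le> x" "x < 1" "c \<le> 0"
  shows "2 \<le> (1 + x) powr c + (1 - x) powr c"
proof -
  let ?u = "(1 + x) powr c" and ?v = "(1 - x) powr c"
  have "(1 + x) * (1 - x) \<le> 1"
    by (simp add: algebra_simps)
  moreover have "0 < (1 + x) * (1 - x)"
    using assms by simp
  ultimately have "1 powr c \<le> ((1 + x) * (1 - x)) powr c"
    using assms(3) by (intro powr_mono2') auto
  then have "1 \<le> ?u * ?v"
    using assms by (simp add: powr_mult)
  then have "2\<^sup>2 \<le> (?u + ?v)\<^sup>2"
    using sum_squares_bound[of ?u ?v] by (simp add: power2_sum)
  then show ?thesis
    by (rule power2_le_imp_le) simp
qed

text \<open>The exponent -3 is chosen because the right-hand side is then an explicit second derivative,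
  that of \<open>(x\<^sup>2 + x\<^sup>2 / (1 - x)) / 2\<close>.\<close>

lemma powr_symmetric_sum_le:
  fixes q x :: real
  assumes "0 \<le> x" "x < 1" "0 \<le> q" "q \<le> 2"
  shows "(1 + x) powr (q - 2) + (1 - x) powr (q - 2) \<le> 1 + 1 / (1 - x) ^ 3"
proof -
  have "(1 + x) powr (q - 2) \<le> 1 powr (q - 2)"
    using assms by (intro powr_mono2') auto
  moreover have "(1 - x) powr (q - 2) \<le> (1 - x) powr (-3)"
    using assms by (intro powr_mono') auto
  moreover have "(1 - x) powr (-3) = 1 / (1 - x) ^ 3"
    using assms by (simp add: powr_minus_divide)
  ultimately show ?thesis by simp
qed

lemma powr_symmetric_defect_lower:
  fixes q s :: real
  assumes "0 \<le> s" "s < 1" "0 \<le> q" "q < 1"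
  shows "q * (1 - q) * s\<^sup>2 \<le> 2 - (1 + s) powr q - (1 - s) powr q"
proof (rule le_by_second_derivative[OF \<open>0 \<le> s\<close>, where
      f' = "\<lambda>x. q * (1 - q) * (2 * x)" and f'' = "\<lambda>x. q * (1 - q) * 2" and
      g' = "\<lambda>x. q * ((1 - x) powr (q - 1) - (1 + x) powr (q - 1))" and
      g'' = "\<lambda>x. q * (1 - q) * ((1 + x) powr (q - 2) + (1 - x) powr (q - 2))"])
  fix x assume x: "0 \<le> x" "x \<le> s"
  show "((\<lambda>s. q * (1 - q) * s\<^sup>2) has_real_derivative q * (1 - q) * (2 * x)) (at x)"
    "((\<lambda>x. q * (1 - q) * (2 * x)) has_real_derivative q * (1 - q) * 2) (at x)"
    by (auto intro!: derivative_eq_intros)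
  from x assms have "x < 1" by simp
  note powr_symmetric_defect_derivatives[OF \<open>0 \<le> x\<close> this, of q]
  then show "((\<lambda>s. 2 - (1 + s) powr q - (1 - s) powr q) has_real_derivative
            q * ((1 - x) powr (q - 1) - (1 + x) powr (q - 1))) (at x)"
    "((\<lambda>x. q * ((1 - x) powr (q - 1) - (1 + x) powr (q - 1))) has_real_derivative
            q * (1 - q) * ((1 + x) powr (q - 2) + (1 - x) powr (q - 2))) (at x)"
    by blast+
  show "q * (1 - q) * 2 \<le> q * (1 - q) * ((1 + x) powr (q - 2) + (1 - x) powr (q - 2))"
    using assms \<open>0 \<le> x\<close> \<open>x < 1\<close> by (intro mult_left_mono two_le_powr_symmetric_sum) auto
qed auto

lemma powr_symmetric_defect_upper:
  fixes q s :: real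
  assumes "0 \<le> s" "s < 1" "0 \<le> q" "q < 1"
  shows "2 - (1 + s) powr q - (1 - s) powr q \<le> q * (1 - q) * (s\<^sup>2 / 2 * (1 + 1 / (1 - s)))"
proof -
  let ?c = "q * (1 - q)"
  \<comment> \<open>Polynomial division turns \<open>s\<^sup>2 / (1 - s)\<close> into \<open>1 / (1 - s) - s - 1\<close>, which is easy to
    differentiate twice.\<close>
  have "2 - (1 + s) powr q - (1 - s) powr q \<le> ?c * ((s\<^sup>2 - s - 1 + 1 / (1 - s)) / 2)"
  proof (rule le_by_second_derivative[OF \<open>0 \<le> s\<close>, where
        f' = "\<lambda>x. q * ((1 - x) powr (q - 1) - (1 + x) powr (q - 1))" and
        f'' = "\<lambda>x. ?c * ((1 + x) powr (q - 2) + (1 - x) powr (q - 2))" and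
        g' = "\<lambda>x. ?c * ((2 * x - 1 + 1 / (1 - x)\<^sup>2) / 2)" and
        g'' = "\<lambda>x. ?c * (1 + 1 / (1 - x) ^ 3)"])
    fix x assume x: "0 \<le> x" "x \<le> s"
    then have "x < 1" using assms by simp
    then show "((\<lambda>s. ?c * ((s\<^sup>2 - s - 1 + 1 / (1 - s)) / 2)) has_real_derivative
        ?c * ((2 * x - 1 + 1 / (1 - x)\<^sup>2) / 2)) (at x)"
      by (auto intro!: derivative_eq_intros simp: power2_eq_square)
    have "((\<lambda>x. 1 / (1 - x)\<^sup>2) has_real_derivative 2 / (1 - x) ^ 3) (at x)"
      using \<open>x < 1\<close>
      by (auto intro!: derivative_eq_intros simp: divide_simps eval_nat_numeral)
    then have "((\<lambda>x. ?c * ((2 * x - 1 + 1 / (1 - x)\<^sup>2) / 2)) has_real_derivative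
        ?c * ((2 + 2 / (1 - x) ^ 3) / 2)) (at x)"
      by (intro DERIV_cmult DERIV_cdivide DERIV_add) (auto intro!: derivative_eq_intros)
    then show "((\<lambda>x. ?c * ((2 * x - 1 + 1 / (1 - x)\<^sup>2) / 2)) has_real_derivative
        ?c * (1 + 1 / (1 - x) ^ 3)) (at x)"
      by (simp add: add_divide_distrib)
    note powr_symmetric_defect_derivatives[OF \<open>0 \<le> x\<close> \<open>x < 1\<close>, of q]
    then show "((\<lambda>s. 2 - (1 + s) powr q - (1 - s) powr q) has_real_derivative
            q * ((1 - x) powr (q - 1) - (1 + x) powr (q - 1))) (at x)"
      "((\<lambda>x. q * ((1 - x) powr (q - 1) - (1 + x) powr (q - 1))) has_real_derivative
            q * (1 - q) * ((1 + x) powr (q - 2) + (1 - x) powr (q - 2))) (at x)"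
      by blast+
    show "?c * ((1 + x) powr (q - 2) + (1 - x) powr (q - 2)) \<le> ?c * (1 + 1 / (1 - x) ^ 3)"
      using assms \<open>0 \<le> x\<close> \<open>x < 1\<close> by (intro mult_left_mono powr_symmetric_sum_le) auto
  qed auto
  also have "(s\<^sup>2 - s - 1 + 1 / (1 - s)) / 2 = s\<^sup>2 / 2 * (1 + 1 / (1 - s))"
    using assms by (simp add: field_simps power2_eq_square)
  finally show ?thesis .
qed

text \<open>Since \<open>J\<close> and both bounds are homogeneous of degree 1 in \<open>(a, b)\<close>, dividing by the mean
  \<open>m\<close> leaves the single parameter \<open>s\<close>, the relative deviation from the mean, and the bounds on
  the symmetric defect of \<open>powr\<close> apply.\<close>

lemma jensen_shannon_tsallis_summand_bounds_ordered:
  fixes a b q :: real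
  assumes "0 < b" "b \<le> a" "0 \<le> q" "q < 1"
  defines "J \<equiv> ((a - a powr q * ((a + b) / 2) powr (1 - q)) / (1 - q)
               + (b - b powr q * ((a + b) / 2) powr (1 - q)) / (1 - q)) / 2"
  shows "q / 8 * ((a - b)\<^sup>2 * (1 / (a + a) + 1 / (b + a))) \<le> J"
    and "J \<le> q / 8 * ((a - b)\<^sup>2 * (1 / (a + b) + 1 / (b + b)))"
proof -
  define m where "m = (a + b) / 2"
  define s where "s = (a - b) / (a + b)"
  have m: "0 < m" and s: "0 \<le> s" "s < 1"
    using assms(1-4) by (auto simp: m_def s_def)
  have a: "a = m * (1 + s)" and b: "b = m * (1 - s)"
    using assms(1,2) by (simp_all add: m_def s_def field_simps)
  have hom: "(m * t) powr q * m powr (1 - q) = m * t powr q" if "0 < t" for t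
  proof -
    have "m powr q * m powr (1 - q) = m"
      using m by (simp flip: powr_add)
    then show ?thesis
      using m that by (simp add: powr_mult mult_ac)
  qed
  have "J = (a + b - (a powr q * m powr (1 - q) + b powr q * m powr (1 - q))) / (2 * (1 - q))"
    unfolding J_def m_def[symmetric] add_divide_distrib[symmetric] divide_divide_eq_left
    by (simp add: algebra_simps)
  also have "a powr q * m powr (1 - q) = m * (1 + s) powr q"
    using hom[of "1 + s"] s by (simp add: a)
  also have "b powr q * m powr (1 - q) = m * (1 - s) powr q"
    using hom[of "1 - s"] s by (simp add: b)
  finally have J: "J = m / (2 * (1 - q)) * (2 - (1 + s) powr q - (1 - s) powr q)"
    using assms(4) by (simp add: a b field_simps)
  have scale: "0 \<le> m / (2 * (1 - q))"
    using m assms(4) by simp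
  have diff: "(a - b)\<^sup>2 = 4 * m\<^sup>2 * s\<^sup>2"
    by (simp add: a b algebra_simps power2_eq_square)
  have denoms: "a + b = 2 * m" "b + a = 2 * m" "a + a = 2 * m * (1 + s)" "b + b = 2 * m * (1 - s)"
    by (simp_all add: a b algebra_simps)
  have "q / 8 * ((a - b)\<^sup>2 * (1 / (a + a) + 1 / (b + a))) = q * m * s\<^sup>2 / 4 * (1 + 1 / (1 + s))"
    unfolding diff denoms using m s by (simp add: divide_simps power2_eq_square)
  also have "\<dots> \<le> q * m * s\<^sup>2 / 4 * 2"
    using m s assms(3) by (intro mult_left_mono) auto
  also have "\<dots> = m / (2 * (1 - q)) * (q * (1 - q) * s\<^sup>2)"
    using assms(4) by (simp add: field_simps)
  also have "\<dots> \<le> J"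
    unfolding J using powr_symmetric_defect_lower[OF s assms(3,4)] scale by (rule mult_left_mono)
  finally show "q / 8 * ((a - b)\<^sup>2 * (1 / (a + a) + 1 / (b + a))) \<le> J" .
  have "J \<le> m / (2 * (1 - q)) * (q * (1 - q) * (s\<^sup>2 / 2 * (1 + 1 / (1 - s))))"
    unfolding J using powr_symmetric_defect_upper[OF s assms(3,4)] scale by (rule mult_left_mono)
  also have "\<dots> = q * m * s\<^sup>2 / 4 * (1 + 1 / (1 - s))"
    using assms(4) by (simp add: divide_simps)
  also have "\<dots> = q / 8 * ((a - b)\<^sup>2 * (1 / (a + b) + 1 / (b + b)))"
    unfolding diff denoms using m s by (simp add: divide_simps power2_eq_square)
  finally show "J \<le> q / 8 * ((a - b)\<^sup>2 * (1 / (a + b) + 1 / (b + b)))" .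
qed

lemma jensen_shannon_tsallis_summand_bounds:
  fixes a b q :: real
  assumes "0 < a" "0 < b" "0 \<le> q" "q < 1"
  defines "J \<equiv> ((a - a powr q * ((a + b) / 2) powr (1 - q)) / (1 - q)
               + (b - b powr q * ((a + b) / 2) powr (1 - q)) / (1 - q)) / 2"
  shows "q / 8 * ((a - b)\<^sup>2 * (1 / (a + max a b) + 1 / (b + max a b))) \<le> J"
    and "J \<le> q / 8 * ((a - b)\<^sup>2 * (1 / (a + min a b) + 1 / (b + min a b)))"
proof -
  have "q / 8 * ((a - b)\<^sup>2 * (1 / (a + max a b) + 1 / (b + max a b))) \<le> J
      \<and> J \<le> q / 8 * ((a - b)\<^sup>2 * (1 / (a + min a b) + 1 / (b + min a b)))"
  proof (cases "b \<le> a")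
    case True
    then show ?thesis
      unfolding J_def
      using jensen_shannon_tsallis_summand_bounds_ordered[OF assms(2) True assms(3,4)]
      by (simp add: True max.absorb1 min.absorb2)
  next
    case False
    then have "a \<le> b" by simp
    then show ?thesis
      unfolding J_def
      using jensen_shannon_tsallis_summand_bounds_ordered[OF assms(1) \<open>a \<le> b\<close> assms(3,4)]
      by (simp add: \<open>a \<le> b\<close> max.absorb2 min.absorb1 add.commute power2_commute[of a b])
  qed
  then show "q / 8 * ((a - b)\<^sup>2 * (1 / (a + max a b) + 1 / (b + max a b))) \<le> J"
    and "J \<le> q / 8 * ((a - b)\<^sup>2 * (1 / (a + min a b) + 1 / (b + min a b)))"
    by blast+
qed

theorem theorem3p8:
  fixes n :: nat and p r :: "nat \<Rightarrow> real" and q :: real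
  assumes p_pos: "\<And>j. j \<in> {1..n} \<Longrightarrow> p j > 0"
    and r_pos: "\<And>j. j \<in> {1..n} \<Longrightarrow> r j > 0"
    and p_sum: "(\<Sum>j=1..n. p j) = 1"
    and r_sum: "(\<Sum>j=1..n. r j) = 1"
    and q: "0 \<le> q" "q < 1"
  shows "q / 8 * (\<Sum>j=1..n. (p j - r j)^2 *
             (1 / (p j + max (p j) (r j)) + 1 / (r j + max (p j) (r j))))
           \<le> jensen_shannon_tsallis q n p r
       \<and> jensen_shannon_tsallis q n p r
           \<le> q / 8 * (\<Sum>j=1..n. (p j - r j)^2 *
             (1 / (p j + min (p j) (r j)) + 1 / (r j + min (p j) (r j))))"
proof -
  have JS: "jensen_shannon_tsallis q n p r =
      (\<Sum>j=1..n. ((p j - p j powr q * ((p j + r j) / 2) powr (1 - q)) / (1 - q)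
                + (r j - r j powr q * ((p j + r j) / 2) powr (1 - q)) / (1 - q)) / 2)"
    unfolding jensen_shannon_tsallis_def tsallis_divergence_def
      sum_divide_distrib[symmetric] sum.distrib
    by (simp add: add_divide_distrib mult.commute)
  show ?thesis
    unfolding JS sum_distrib_left
    using p_pos r_pos q
    by (intro conjI sum_mono jensen_shannon_tsallis_summand_bounds) auto
qed

end
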